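(* Let $p>0$. For all real $m\ge 1$ and all $x>0$, $$V_m^p(x)=\frac1m\left[\left(m-1+\frac1p-x^p\right)V_{m-1}^p(x)+x^pV_{m-2}^p(x)\right].$$
   Context: For real $p>0$, real $m>-1$ and $x>0$, $V_m^p(x)=\frac{p e^{x^p}}{\Gamma(m+1)}\int_x^\infty (t^p-x^p)^m e^{-t^p}\,dt=\frac{1}{\Gamma(m+1)}\int_0^\infty \frac{u^m e^{-u}}{(x^p+u)^{(p-1)/p}}\,du$. By convention $V_{-1}^p(x)=x^{1-p}$. *)

theory Defs
  imports "HOL-Analysis.Analysis"
begin

text \<open>
  The parameters are meant to satisfy \<open>p > 0\<close>, \<open>m \<ge> -1\<close> and \<open>x > 0\<close>; for \<open>m > -1\<close> the integrand is
  then positive on \<open>{x<..}\<close> and Lebesgue integrable, with a singularity at the excluded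
  endpoint \<open>x\<close> if \<open>m < 0\<close>. The value at \<open>m = -1\<close>, where the integral diverges and
  \<open>Gamma (m + 1)\<close> is the junk value \<open>0\<close>, is a convention.
\<close>

definition V :: "real \<Rightarrow> real \<Rightarrow> real \<Rightarrow> real" where
  "V p m x =
     (if m = -1 then x powr (1 - p)
      else p * exp (x powr p) / Gamma (m + 1) *
           (LINT t:{x<..}|lborel. (t powr p - x powr p) powr m * exp (- (t powr p))))"

end

theory Submission
  imports Defs "HOL-Real_Asymp.Real_Asymp"
begin

text \<open>
  Write \<open>a = x powr p\<close>, \<open>w = t powr p - a\<close> and
  \<open>J s = \<integral>\<^sub>x\<^sup>\<infinity> w powr s * exp (- (t powr p)) dt\<close>, so that \<open>V p s x\<close> is
  \<open>p * exp a / Gamma (s + 1) * J s\<close> for \<open>s > -1\<close>. The recurrence is a single integration by parts,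
  carried out in the variable \<open>t\<close>: since \<open>t * w' = p * t powr p = p * (w + a)\<close>, the derivative of
  \<open>t * w powr s * exp (- (t powr p))\<close> is a combination of the integrands of \<open>J (s - 1)\<close>,
  \<open>J s\<close> and \<open>J (s + 1)\<close> with constant coefficients. Integrating over \<open>{x<..}\<close> gives
  \<open>V_integral_recurrence\<close>; putting \<open>s = m - 1\<close> and dividing by \<open>Gamma (m + 1)\<close>, with
  \<open>Gamma (z + 1) = z * Gamma z\<close>, gives the theorem.

  The boundary term at \<open>x\<close> vanishes for \<open>s > 0\<close>. For \<open>s = 0\<close>, that is \<open>m = 1\<close>, it is
  \<open>x * exp (- a)\<close>, and the term with \<open>J (-1)\<close> has the coefficient \<open>0\<close>. The convention
  \<open>V p (-1) x = x powr (1 - p)\<close> is exactly what lets this boundary term take the place of the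
  missing one, because \<open>a * x powr (1 - p) = x\<close>.

  The fundamental theorem of calculus needs the integrals to converge, which for
  \<open>-1 < s < 0\<close> includes a singularity at \<open>x\<close>; this is \<open>set_integrable_V_integrand\<close>.
\<close>

section \<open>Limits and antiderivatives on a half-line\<close>

lemma FTC_half_line:
  fixes F f :: "real \<Rightarrow> real"
  assumes F: "\<And>t. x < t \<Longrightarrow> (F has_real_derivative f t) (at t)"
    and cont: "\<And>t. x < t \<Longrightarrow> isCont f t"
    and lim_x: "(F \<longlongrightarrow> A) (at_right x)"
    and lim_top: "(F \<longlongrightarrow> B) at_top"
  shows FTC_half_line_nonneg: "(\<And>t. x < t \<Longrightarrow> 0 \<le> f t) \<Longrightarrow> set_integrable lborel {x<..} f"
    and FTC_half_line_integral: "set_integrable lborel {x<..} f \<Longrightarrow> (LINT t:{x<..}|lborel. f t) = B - A"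
proof -
  have lims: "((F \<circ> real_of_ereal) \<longlongrightarrow> A) (at_right (ereal x))"
    "((F \<circ> real_of_ereal) \<longlongrightarrow> B) (at_left \<infinity>)"
    using lim_x lim_top by (simp_all add: ereal_tendsto_simps)
  show "set_integrable lborel {x<..} f" if "\<And>t. x < t \<Longrightarrow> 0 \<le> f t"
    using interval_integral_FTC_nonneg(1)[of "ereal x" \<infinity> F f A B] F cont lims that
    by simp
  show "(LINT t:{x<..}|lborel. f t) = B - A" if "set_integrable lborel {x<..} f"
    using interval_integral_FTC_integrable[of "ereal x" \<infinity> F f A B] F cont lims that
    by (simp add: interval_integral_to_infinity_eq has_real_derivative_iff_has_vector_derivative)
qed

text \<open>
  The next limit makes boundary terms at \<open>x\<close> vanish. It is one-sided because the base
  \<open>t powr p - x powr p\<close> is negative to the left of \<open>x\<close>.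
\<close>

lemma powr_diff_tendsto_0_at_right:
  fixes p s x :: real
  assumes "x > 0" "p > 0" "s > 0"
  shows "((\<lambda>t. (t powr p - x powr p) powr s) \<longlongrightarrow> 0) (at_right x)"
proof -
  have "((\<lambda>t. t powr p - x powr p) \<longlongrightarrow> x powr p - x powr p) (at_right x)"
    using assms by (intro tendsto_intros) auto
  moreover have "\<forall>\<^sub>F t in at_right x. 0 \<le> t powr p - x powr p"
    using eventually_at_right_less[of x]
    by eventually_elim (use assms in \<open>auto intro!: powr_mono2\<close>)
  ultimately show ?thesis
    using assms tendsto_powr'[of "\<lambda>t. t powr p - x powr p" 0 "at_right x" "\<lambda>_. s" s] by simp
qed

lemma bounded_if_continuous_tendsto_at_top:
  fixes f :: "real \<Rightarrow> real"
  assumes cont: "continuous_on {x..} f" and lim: "(f \<longlongrightarrow> l) at_top"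
  obtains C where "\<And>t. x \<le> t \<Longrightarrow> \<bar>f t\<bar> \<le> C"
proof -
  obtain T where T: "\<And>t. T \<le> t \<Longrightarrow> \<bar>f t\<bar> < \<bar>l\<bar> + 1"
    using order_tendstoD(2)[OF tendsto_rabs[OF lim], of "\<bar>l\<bar> + 1"]
    by (auto simp: eventually_at_top_linorder)
  have "compact (f ` {x..T})"
    by (intro compact_continuous_image continuous_on_subset[OF cont]) auto
  then have "bounded (f ` {x..T})" by (rule compact_imp_bounded)
  then obtain C where "\<forall>y\<in>f ` {x..T}. norm y \<le> C"
    unfolding bounded_iff by blast
  then have C: "\<bar>f t\<bar> \<le> C" if "t \<in> {x..T}" for t
    using that by simp
  show thesis
  proof (rule that)
    show "\<bar>f t\<bar> \<le> max C (\<bar>l\<bar> + 1)" if "x \<le> t" for t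
      using T[of t] C[of t] that by (cases "t \<le> T") auto
  qed
qed

section \<open>Convergence of the integrals\<close>

text \<open>
  One comparison function controls both the singularity at \<open>x\<close> and the tail. As a function of
  \<open>w\<close>, the integrand \<open>w powr s * (1 + w) powr (- s - 2)\<close> behaves like \<open>w powr s\<close> near \<open>0\<close>, decays
  like \<open>w powr (-2)\<close> at infinity, and has the bounded antiderivative
  \<open>(w / (1 + w)) powr (s + 1) / (s + 1)\<close>. Substituting \<open>w = t powr p - x powr p\<close> gives an integrable
  function \<open>g\<close> of \<open>t\<close>, and the factor by which the integrand of \<open>V\<close> differs from it is continuous
  on \<open>{x..}\<close> and tends to \<open>0\<close> because of \<open>exp (- (t powr p))\<close>, hence is bounded.
\<close>

lemma set_integrable_V_integrand:
  fixes p s x :: real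
  assumes "p > 0" "s > -1" "x > 0"
  shows "set_integrable lborel {x<..} (\<lambda>t. (t powr p - x powr p) powr s * exp (- (t powr p)))"
proof -
  define w where "w t = t powr p - x powr p" for t
  define G where "G t = (w t / (1 + w t)) powr (s + 1) / (s + 1)" for t
  define g where "g t = w t powr s * (1 + w t) powr (- s - 2) * (p * t powr (p - 1))" for t
  define r where "r t = exp (- (t powr p)) * (1 + w t) powr (s + 2) * t powr (1 - p)" for t
  have w_pos: "0 < w t" if "x < t" for t
    using that assms by (auto simp: w_def intro!: powr_less_mono2)
  have w_nonneg: "0 \<le> w t" if "x \<le> t" for t
    using that w_pos[of t] by (cases "x = t") (auto simp: w_def)
  have "continuous_on {x..} r"
    unfolding r_def w_def using assms w_nonneg
    by (intro continuous_intros) (force simp: w_def)+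
  moreover have "(r \<longlongrightarrow> 0) at_top"
    unfolding r_def w_def using assms by real_asymp
  ultimately obtain C where C: "\<And>t. x \<le> t \<Longrightarrow> \<bar>r t\<bar> \<le> C"
    using bounded_if_continuous_tendsto_at_top by blast
  have "set_integrable lborel {x<..} g"
  proof (rule FTC_half_line_nonneg)
    show "(G has_real_derivative g t) (at t)" if "x < t" for t
    proof -
      have t: "t > 0" "w t > 0" using that assms w_pos by auto
      have w': "(w has_real_derivative p * t powr (p - 1)) (at t)"
        unfolding w_def using t by (auto intro!: derivative_eq_intros simp: powr_diff)
      have "((\<lambda>t. w t / (1 + w t)) has_real_derivative p * t powr (p - 1) / (1 + w t)^2) (at t)"
        using t by (auto intro!: derivative_eq_intros w' simp: power2_eq_square algebra_simps)
      from DERIV_cdivide[OF DERIV_fun_powr[OF this, of "s + 1"], of "s + 1"]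
      have "(G has_real_derivative
          (w t / (1 + w t)) powr s * (p * t powr (p - 1) / (1 + w t)^2)) (at t)"
        using t assms unfolding G_def by simp
      also have "(w t / (1 + w t)) powr s * (p * t powr (p - 1) / (1 + w t)^2) = g t"
        using t by (simp add: g_def powr_divide powr_diff powr_minus field_simps)
      finally show ?thesis .
    qed
    show "isCont g t" if "x < t" for t
      using that assms w_pos[OF that] unfolding g_def w_def
      by (intro continuous_intros) auto
    show "0 \<le> g t" if "x < t" for t
      using that assms by (simp add: g_def)
    have "((\<lambda>t. w t powr (s + 1) / (1 + w t) powr (s + 1) / (s + 1)) \<longlongrightarrow>
        0 / (1 + (x powr p - x powr p)) powr (s + 1) / (s + 1)) (at_right x)"
      unfolding w_def using assms
      by (intro tendsto_intros powr_diff_tendsto_0_at_right) auto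
    moreover have "\<forall>\<^sub>F t in at_right x.
        w t powr (s + 1) / (1 + w t) powr (s + 1) / (s + 1) = G t"
      using eventually_at_right_less[of x]
      by eventually_elim (use w_pos in \<open>auto simp: G_def powr_divide less_imp_le\<close>)
    ultimately show "(G \<longlongrightarrow> 0) (at_right x)"
      by (simp add: tendsto_cong)
    show "(G \<longlongrightarrow> inverse (s + 1)) at_top"
      unfolding G_def w_def using assms by real_asymp
  qed
  then have "set_integrable lborel {x<..} (\<lambda>t. C / p * g t)"
    by simp
  then show ?thesis
  proof (rule set_integrable_bound)
    show "set_borel_measurable lborel {x<..}
        (\<lambda>t. (t powr p - x powr p) powr s * exp (- (t powr p)))"
      unfolding set_borel_measurable_def by measurable
    have "w t powr s * exp (- (t powr p)) \<le> C / p * g t" if "x < t" for t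
    proof -
      have t: "t > 0" "w t > 0" using that assms w_pos by auto
      have "w t powr s * exp (- (t powr p)) = r t * g t / p"
        using t assms
        by (simp add: r_def g_def powr_diff powr_minus powr_add field_simps)
      also have "\<dots> \<le> C * g t / p"
        using assms C[of t] that by (intro divide_right_mono mult_right_mono) (auto simp: g_def)
      finally show ?thesis by simp
    qed
    moreover have "norm ((t powr p - x powr p) powr s * exp (- (t powr p))) =
        w t powr s * exp (- (t powr p))" for t
      by (simp add: w_def)
    ultimately have "norm ((t powr p - x powr p) powr s * exp (- (t powr p))) \<le> norm (C / p * g t)"
      if "x < t" for t
      using that by (metis abs_ge_self order_trans real_norm_def)
    then show "AE t\<in>{x<..} in lborel.
        norm ((t powr p - x powr p) powr s * exp (- (t powr p))) \<le> norm (C / p * g t)"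
      by (intro AE_I2 impI) simp
  qed
qed

section \<open>Integration by parts and the recurrence\<close>

text \<open>
  The terms with \<open>J\<close> come from integrating the derivative of
  \<open>t * (t powr p - x powr p) powr s * exp (- (t powr p))\<close>; the conditional summand is the
  right-hand limit of this function at \<open>x\<close>, and its limit at infinity is \<open>0\<close>. For \<open>s = 0\<close> the integral defining \<open>J (s - 1)\<close> diverges, and its coefficient \<open>s\<close> removes it.
\<close>

lemma V_integral_recurrence:
  fixes p s x :: real
  defines "J \<equiv> \<lambda>s. LINT t:{x<..}|lborel. (t powr p - x powr p) powr s * exp (- (t powr p))"
  assumes "p > 0" "s \<ge> 0" "x > 0"
  shows "p * J (s + 1) = (1 + p * s - p * x powr p) * J s + p * x powr p * (s * J (s - 1)) +
    (if s = 0 then x * exp (- (x powr p)) else 0)"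
proof -
  define w where "w t = t powr p - x powr p" for t
  define h where "h s t = w t powr s * exp (- (t powr p))" for s t
  define F where "F t = t * h s t" for t
  define f where "f t = (1 + p * s - p * x powr p) * h s t +
    p * x powr p * (s * h (s - 1) t) - p * h (s + 1) t" for t
  define A where "A = (if s = 0 then x * exp (- (x powr p)) else 0)"
  have w_pos: "0 < w t" if "x < t" for t
    using that assms by (auto simp: w_def intro!: powr_less_mono2)
  have int: "set_integrable lborel {x<..} (h r)" if "r > -1" for r
    using set_integrable_V_integrand[of p r x] that assms unfolding h_def w_def by simp
  \<comment> \<open>The factor \<open>s\<close> stays inside: at \<open>s = 0\<close> the function \<open>h (s - 1)\<close> is not integrable.\<close>
  have int': "set_integrable lborel {x<..} (\<lambda>t. s * h (s - 1) t)"
  proof (cases "s = 0")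
    case True
    then show ?thesis by (simp add: set_integrable_def)
  next
    case False
    then show ?thesis using int[of "s - 1"] assms by simp
  qed
  have ints: "set_integrable lborel {x<..} (\<lambda>t. (1 + p * s - p * x powr p) * h s t)"
    "set_integrable lborel {x<..} (\<lambda>t. p * x powr p * (s * h (s - 1) t))"
    "set_integrable lborel {x<..} (\<lambda>t. p * h (s + 1) t)"
    using int[of s] int' int[of "s + 1"] assms by simp_all
  have "(LINT t:{x<..}|lborel. f t) = 0 - A"
  proof (rule FTC_half_line_integral)
    show "(F has_real_derivative f t) (at t)" if "x < t" for t
    proof -
      have t: "t > 0" "w t > 0" using that assms w_pos by auto
      have w': "(w has_real_derivative p * t powr (p - 1)) (at t)"
        unfolding w_def using t by (auto intro!: derivative_eq_intros simp: powr_diff)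
      have "(F has_real_derivative
          h s t + t * ((s * w t powr (s - 1) * (p * t powr (p - 1))) * exp (- (t powr p)) -
            w t powr s * (exp (- (t powr p)) * (p * t powr (p - 1))))) (at t)"
        unfolding F_def h_def using t
        by (auto intro!: derivative_eq_intros w' DERIV_fun_powr simp: algebra_simps powr_diff)
      also have "h s t + t * ((s * w t powr (s - 1) * (p * t powr (p - 1))) * exp (- (t powr p)) -
            w t powr s * (exp (- (t powr p)) * (p * t powr (p - 1)))) =
          h s t + p * t powr p * (s * h (s - 1) t - h s t)"
        using t by (simp add: h_def powr_diff[of t] algebra_simps)
      \<comment> \<open>Powers of \<open>t\<close> have to disappear: each factor \<open>w\<close> raises the index of \<open>h\<close> by one.\<close>
      also have "t powr p = w t + x powr p" by (simp add: w_def)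
      also have "h s t + p * (w t + x powr p) * (s * h (s - 1) t - h s t) = f t"
      proof -
        have "w t * h (s - 1) t = h s t" "w t * h s t = h (s + 1) t"
          using t by (simp_all add: h_def powr_diff powr_add)
        moreover have "h s t + p * (w t + x powr p) * (s * h (s - 1) t - h s t) =
            h s t + p * (s * (w t * h (s - 1) t) - w t * h s t) +
            p * x powr p * (s * h (s - 1) t - h s t)"
          by (simp add: algebra_simps)
        ultimately show ?thesis by (simp add: f_def algebra_simps)
      qed
      finally show ?thesis .
    qed
    show "isCont f t" if "x < t" for t
      using that assms w_pos[OF that] unfolding f_def h_def w_def
      by (intro continuous_intros) auto
    show "set_integrable lborel {x<..} f"
      unfolding f_def by (intro set_integral_add set_integral_diff ints)
    show "(F \<longlongrightarrow> A) (at_right x)"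
    proof (cases "s = 0")
      case True
      have "((\<lambda>t. t * exp (- (t powr p))) \<longlongrightarrow> A) (at_right x)"
        unfolding A_def using True assms by (auto intro!: tendsto_eq_intros)
      moreover have "\<forall>\<^sub>F t in at_right x. t * exp (- (t powr p)) = F t"
        using eventually_at_right_less[of x]
        by eventually_elim (use True w_pos in \<open>force simp: F_def h_def\<close>)
      ultimately show ?thesis by (simp add: tendsto_cong)
    next
      case False
      have "((\<lambda>t. t * ((t powr p - x powr p) powr s * exp (- (t powr p)))) \<longlongrightarrow>
          x * (0 * exp (- (x powr p)))) (at_right x)"
        using assms False by (intro tendsto_intros powr_diff_tendsto_0_at_right) auto
      then show ?thesis using False by (simp add: F_def[abs_def] h_def w_def A_def)
    qed
    show "(F \<longlongrightarrow> 0) at_top"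
    proof (cases "s = 0")
      case True
      show ?thesis
        unfolding F_def h_def w_def True using assms by real_asymp
    next
      case False
      then have "s > 0" using assms by simp
      then show ?thesis
        unfolding F_def h_def w_def using assms by real_asymp
    qed
  qed
  moreover have "(LINT t:{x<..}|lborel. f t) =
      (1 + p * s - p * x powr p) * J s + p * x powr p * (s * J (s - 1)) - p * J (s + 1)"
    unfolding f_def J_def h_def[symmetric] w_def[symmetric]
    by (simp add: set_integral_add set_integral_diff ints)
  ultimately show ?thesis by (simp add: A_def)
qed

theorem proposition8:
  fixes p m x :: real
  assumes "p > 0" and "m \<ge> 1" and "x > 0"
  shows "V p m x =
           1 / m * ((m - 1 + 1 / p - x powr p) * V p (m - 1) x + x powr p * V p (m - 2) x)"
proof -
  define a where "a = x powr p"
  define J where "J s = (LINT t:{x<..}|lborel. (t powr p - a) powr s * exp (- (t powr p)))" for s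
  have V: "V p s x = p * exp a / Gamma (s + 1) * J s" if "s \<noteq> -1" for s
    using that by (simp add: V_def a_def J_def)
  define R where "R = p * a * ((m - 1) * J (m - 2)) + (if m = 1 then x * exp (- a) else 0)"
  have Gamma_m: "Gamma (m + 1) = m * Gamma m"
    using assms Gamma_plus1[of m] nonpos_Ints_nonpos[of m] by force
  have "p * J m = (1 + p * (m - 1) - p * a) * J (m - 1) + R"
    using V_integral_recurrence[of p "m - 1" x] assms by (simp add: J_def a_def R_def)
  also have "1 + p * (m - 1) - p * a = p * (m - 1 + 1 / p - a)"
    using assms by (simp add: algebra_simps)
  finally have rec: "p * J m = p * (m - 1 + 1 / p - a) * J (m - 1) + R" .
  \<comment> \<open>Only the first summand of \<open>R\<close> contributes if \<open>m > 1\<close>, only the boundary term if \<open>m = 1\<close>.\<close>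
  have a_V: "a * V p (m - 2) x = exp a / Gamma m * R"
  proof (cases "m = 1")
    case True
    then show ?thesis
      using assms by (simp add: R_def V_def a_def exp_minus flip: powr_add)
  next
    case False
    have "Gamma m = (m - 1) * Gamma (m - 1)"
      using assms False Gamma_plus1[of "m - 1"] nonpos_Ints_nonpos[of "m - 1"] by force
    moreover have "Gamma (m - 1) > 0" using assms False by (simp add: Gamma_real_pos)
    ultimately have "1 / Gamma (m - 1) = (m - 1) / Gamma m"
      using False by simp
    moreover have "V p (m - 2) x = p * exp a * J (m - 2) * (1 / Gamma (m - 1))"
      using assms False V[of "m - 2"] by simp
    ultimately show ?thesis
      using False by (simp add: R_def)
  qed
  have "V p m x = exp a / (m * Gamma m) * (p * J m)"
    using assms by (simp add: V Gamma_m)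
  also have "\<dots> = 1 / m * ((m - 1 + 1 / p - a) * (p * exp a / Gamma m * J (m - 1)) +
      a * V p (m - 2) x)"
    unfolding rec a_V by (simp add: distrib_left)
  also have "p * exp a / Gamma m * J (m - 1) = V p (m - 1) x"
    using assms by (simp add: V)
  finally show ?thesis by (simp add: a_def)
qed

end
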